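(* Let $\mathcal{I}$ be a finite set of items and $\mathcal{G}$ a finite set of groups, each item belonging to exactly one group, with $\mathcal{I}_g\subseteq\mathcal{I}$ the set of items of group $g$. Let $T\ge 1$ be the number of time steps and $K$ (with $1\le K\le|\mathcal{I}|$) the size of the list retrieved at each step. Let $r_{u_t,i}=-d(\mathbf{e}_{u_t},\mathbf{e}_i)\in\mathbb{R}$ be the relevance score of item $i\in\mathcal{I}$ for the user $u_t$ arriving at time $t=1,\dots,T$, and let $m_g$, $g\in\mathcal{G}$, be given real thresholds (minimum exposure requirements). Consider the primal problem $$ \begin{aligned} (P)\qquad \max_{x}\quad & \sum_{t=1}^T\sum_{i\in\mathcal{I}} x_{u_t,i}\, r_{u_t,i}\\ \text{s.t.}\quad & \sum_{i\in\mathcal{I}} x_{u_t,i}=K,\quad t=1,\dots,T,\\ & e_g=\sum_{t=1}^T\sum_{i\in\mathcal{I}_g}x_{u_t,i},\quad \forall g\in\mathcal{G},\\ & e_g\ge m_g,\quad \forall g\in\mathcal{G},\\ & x_{u_t,i}\in\{0,1\},\quad t=1,\dots,T,\ i\in\mathcal{I}. \end{aligned} $$ Let $\mathbf{A}\in\mathbb{R}^{|\mathcal{I}|\times|\mathcal{G}|}$ be the item-group adjacency matrix, $A_{ig}=1$ if $i\in\mathcal{I}_g$ and $A_{ig}=0$ otherwise, and let $r_{u_t}=(r_{u_t,i})_{i\in\mathcal{I}}\in\mathbb{R}^{|\mathcal{I}|}$. Then the dual problem of $(P)$, with dual variable $\mu\in\mathbb{R}^{|\mathcal{G}|}$, can be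 written as $$ W^{\mathrm{Dual}}=\min_{\mu\in\mathbb{R}^{|\mathcal{G}|}}\left[\sum_{t=1}^T\sum_{k=1}^K\bigl(r_{u_t}-\mathbf{A}\mu\bigr)_{[k]}+\sum_{g\in\mathcal{G}}m_g\mu_g+\max_{g\in\mathcal{G}}\{\mu_g\}\Bigl(TK-\sum_{g\in\mathcal{G}}m_g\Bigr)\right]. $$ Moreover, strong duality holds: the optimal value $W^{\mathrm{Dual}}$ of this dual problem is the same as the optimal value of $(P)$.
   Context: For a vector $a\in\mathbb{R}^N$, $a_{[k]}$ denotes the $k$-th largest entry of $a$. Interpretation: users $u_1,\dots,u_T$ arrive sequentially; at each time $t$ a list of $K$ items is retrieved, and $x_{u_t,i}=1$ if item $i$ is in the list for time $t$, and $x_{u_t,i}=0$ otherwise (there is a separate decision variable for each pair $(t,i)$). The items are stored on servers which together hold all of $\mathcal{I}$. The vectors $\mathbf{e}_{u_t},\mathbf{e}_i$ are real embedding vectors of the user and the item, and $d$ is a real-valued distance measure (commonly $d(\mathbf{e}_u,\mathbf{e}_i)=-\mathbf{e}_u^\top\mathbf{e}_i$). The number $e_g$ is the total number of exposures of group $g$ accumulated over times $1,\dots,T$, and the platform requires it to be at least the threshold $m_g$. The dual of $(P)$ is the Lagrangian dual obtained by dualizing the linking constraints $e_g=\sum_{t}\sum_{i\in\mathcal{I}_g}x_{u_t,i}$ with multipliers $\mu_g$, keeping the implied constraint $\sum_g e_g=TK$ on the variables $e_g$; that is, $$\min_{\mu\in\mathbb{R}^{|\mathcal{G}|}}\ \max_{x\in\mathcal{X},\,e\in\mathcal{E}}\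 \left[\sum_{t=1}^T\sum_{i\in\mathcal{I}}\bigl(r_{u_t,i}-(\mathbf{A}\mu)_i\bigr)x_{u_t,i}+\sum_{g\in\mathcal{G}}\mu_g e_g\right],$$ where $\mathcal{X}=\{x: x_{u_t,i}\in\{0,1\},\ \sum_{i\in\mathcal{I}}x_{u_t,i}=K\ \text{for all } t\}$ and $\mathcal{E}=\{e\in\mathbb{R}^{|\mathcal{G}|}: e_g\ge m_g\ \text{for all } g,\ \sum_{g}e_g=TK\}$.
   Formalization: The thresholds are assumed to satisfy sum_g m_g <= TK; strong duality is claimed only for integer m_g (it fails for fractional thresholds); the dual minimum is claimed attained only when (P) is feasible, otherwise it is read as an infimum. *)

theory Defs
  imports "HOL-Analysis.Analysis" "HOL-Library.Multiset"
begin

text \<open>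
  Items and groups are the elements of the finite types \<open>'i\<close> and \<open>'g\<close>; \<open>Ig g\<close> is the set of items
  of group \<open>g\<close>. Times are \<open>1, \<dots>, T\<close>; a decision is a function \<open>x\<close> with one 0/1 vector \<open>x t\<close>
  per time, and its values outside \<open>{1..T}\<close> are irrelevant.
\<close>

text \<open>Ranks are 1-based and entries are counted with multiplicity.\<close>

definition kth_largest :: "real ^ 'n \<Rightarrow> nat \<Rightarrow> real" where
  "kth_largest a k =
     rev (sorted_list_of_multiset (image_mset (\<lambda>j. a $ j) (mset_set UNIV))) ! (k - 1)"

definition relevance ::
    "(real ^ 'p \<Rightarrow> real ^ 'p \<Rightarrow> real) \<Rightarrow> ('u \<Rightarrow> real ^ 'p) \<Rightarrow> ('i \<Rightarrow> real ^ 'p) \<Rightarrow> (nat \<Rightarrow> 'u)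
      \<Rightarrow> nat \<Rightarrow> real ^ 'i" where
  "relevance d emb_user emb_item u t = (\<chi> i. - d (emb_user (u t)) (emb_item i))"

definition adjacency :: "('g \<Rightarrow> 'i set) \<Rightarrow> real ^ 'g ^ 'i" where
  "adjacency Ig = (\<chi> i g. if i \<in> Ig g then 1 else 0)"

definition decisions :: "nat \<Rightarrow> nat \<Rightarrow> (nat \<Rightarrow> real ^ 'i) set" where
  "decisions T K =
     {x. \<forall>t\<in>{1..T}. (\<forall>i. x t $ i \<in> {0, 1}) \<and> (\<Sum>i\<in>UNIV. x t $ i) = real K}"

definition exposure :: "nat \<Rightarrow> ('g \<Rightarrow> 'i set) \<Rightarrow> (nat \<Rightarrow> real ^ 'i) \<Rightarrow> 'g \<Rightarrow> real" where
  "exposure T Ig x g = (\<Sum>t=1..T. \<Sum>i\<in>Ig g. x t $ i)"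

definition primal_feasible ::
    "nat \<Rightarrow> nat \<Rightarrow> ('g \<Rightarrow> 'i set) \<Rightarrow> real ^ 'g \<Rightarrow> (nat \<Rightarrow> real ^ 'i) set" where
  "primal_feasible T K Ig m = {x \<in> decisions T K. \<forall>g. exposure T Ig x g \<ge> m $ g}"

definition primal_objective :: "nat \<Rightarrow> (nat \<Rightarrow> real ^ 'i) \<Rightarrow> (nat \<Rightarrow> real ^ 'i) \<Rightarrow> real" where
  "primal_objective T r x = (\<Sum>t=1..T. \<Sum>i\<in>UNIV. x t $ i * r t $ i)"

text \<open>Optimal values are extended reals: an infeasible maximization problem has value \<open>-\<infinity>\<close>.\<close>

definition primal_value ::
    "nat \<Rightarrow> nat \<Rightarrow> (nat \<Rightarrow> real ^ 'i) \<Rightarrow> ('g \<Rightarrow> 'i set) \<Rightarrow> real ^ 'g \<Rightarrow> ereal" where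
  "primal_value T K r Ig m = (SUP x\<in>primal_feasible T K Ig m. ereal (primal_objective T r x))"

definition exposure_vectors :: "nat \<Rightarrow> nat \<Rightarrow> real ^ 'g \<Rightarrow> (real ^ 'g) set" where
  "exposure_vectors T K m =
     {e. (\<forall>g. e $ g \<ge> m $ g) \<and> (\<Sum>g\<in>UNIV. e $ g) = real T * real K}"

definition lagrangian ::
    "nat \<Rightarrow> (nat \<Rightarrow> real ^ 'i) \<Rightarrow> ('g \<Rightarrow> 'i set) \<Rightarrow> real ^ 'g \<Rightarrow> (nat \<Rightarrow> real ^ 'i) \<Rightarrow> real ^ 'g \<Rightarrow> real" where
  "lagrangian T r Ig \<mu> x e =
     (\<Sum>t=1..T. \<Sum>i\<in>UNIV. (r t $ i - (adjacency Ig *v \<mu>) $ i) * x t $ i)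
     + (\<Sum>g\<in>UNIV. \<mu> $ g * e $ g)"

definition dual_function ::
    "nat \<Rightarrow> nat \<Rightarrow> (nat \<Rightarrow> real ^ 'i) \<Rightarrow> ('g \<Rightarrow> 'i set) \<Rightarrow> real ^ 'g \<Rightarrow> real ^ 'g \<Rightarrow> ereal" where
  "dual_function T K r Ig m \<mu> =
     (SUP (x, e)\<in>decisions T K \<times> exposure_vectors T K m. ereal (lagrangian T r Ig \<mu> x e))"

definition dual_value ::
    "nat \<Rightarrow> nat \<Rightarrow> (nat \<Rightarrow> real ^ 'i) \<Rightarrow> ('g \<Rightarrow> 'i set) \<Rightarrow> real ^ 'g \<Rightarrow> ereal" where
  "dual_value T K r Ig m = (INF \<mu>. dual_function T K r Ig m \<mu>)"

definition dual_objective ::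
    "nat \<Rightarrow> nat \<Rightarrow> (nat \<Rightarrow> real ^ 'i) \<Rightarrow> ('g \<Rightarrow> 'i set) \<Rightarrow> real ^ 'g \<Rightarrow> real ^ 'g \<Rightarrow> real" where
  "dual_objective T K r Ig m \<mu> =
     (\<Sum>t=1..T. \<Sum>k=1..K. kth_largest (r t - adjacency Ig *v \<mu>) k)
     + (\<Sum>g\<in>UNIV. m $ g * \<mu> $ g)
     + Max (range (\<lambda>g. \<mu> $ g)) * (real T * real K - (\<Sum>g\<in>UNIV. m $ g))"

end

theory Submission
  imports Defs
begin

text \<open>
  For fixed \<open>\<mu>\<close> the Lagrangian separates: each time step contributes a sum of the \<open>K\<close> largest entries,
  and a linear function on the simplex of exposure vectors is maximal at a vertex.

  For strong duality, take an optimal \<open>x\<close> and consider the digraph on the groups with an arc from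
  \<open>g\<close> to \<open>h\<close>, weighted by its gain, for every swap of an item of \<open>g\<close> against an item of \<open>h\<close> within
  one list, and an arc of weight 0 into every group whose exposure exceeds its threshold. A cycle of
  positive weight would give a feasible improvement of \<open>x\<close>, so there is a potential \<open>\<mu>\<close> on the groups,
  and complementary slackness makes the dual objective at \<open>\<mu>\<close> equal to the primal objective at \<open>x\<close>. The
  improvement moves entries by a step \<open>\<delta>\<close>: with \<open>\<delta> = 1\<close> it stays integral, which settles integral
  thresholds; with a small \<open>\<delta>\<close> it applies to an optimum of the linear relaxation, which shows that the
  dual minimum is attained for arbitrary real thresholds.
\<close>

subsection \<open>Sums of the largest entries\<close>

text \<open>A threshold separates the entries: \<open>x\<close> is 1 where \<open>v\<close> exceeds
  it and 0 where \<open>v\<close> lies below. So each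
  \<open>(v $ i - \<theta>) * (y $ i - x $ i)\<close> is at most 0, and \<open>\<theta>\<close>
  drops out because both vectors have the same total.\<close>

lemma exchange_optimal:
  fixes v x y :: "real ^ 'i::finite"
  assumes x: "\<And>i. 0 \<le> x $ i \<and> x $ i \<le> 1" and y: "\<And>i. 0 \<le> y $ i \<and> y $ i \<le> 1"
    and sum_eq: "(\<Sum>i\<in>UNIV. y $ i) = (\<Sum>i\<in>UNIV. x $ i)"
    and exch: "\<And>i j. 0 < x $ i \<Longrightarrow> x $ j < 1 \<Longrightarrow> v $ j \<le> v $ i"
  shows "(\<Sum>i\<in>UNIV. v $ i * y $ i) \<le> (\<Sum>i\<in>UNIV. v $ i * x $ i)"
proof (cases "\<exists>i. 0 < x $ i")
  case False
  then have x0: "x $ i = 0" for i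
    using x[of i] by (metis order_le_less)
  then have "y $ i = 0" for i
    using sum_eq y by (simp add: sum_nonneg_eq_0_iff)
  then show ?thesis by (simp add: x0)
next
  case True
  \<comment> \<open>The least value of \<open>v\<close> on the support of \<open>x\<close>; by
    \<open>exch\<close> it bounds \<open>v\<close> on the entries that \<open>x\<close> does not
    fill.\<close>
  define \<theta> where "\<theta> = Min ((\<lambda>i. v $ i) ` {i. 0 < x $ i})"
  have fin: "finite ((\<lambda>i. v $ i) ` {i. 0 < x $ i})" by simp
  have upper: "\<theta> \<le> v $ i" if "0 < x $ i" for i
    unfolding \<theta>_def using that fin by (intro Min_le) auto
  have "\<theta> \<in> (\<lambda>i. v $ i) ` {i. 0 < x $ i}"
    unfolding \<theta>_def using True fin by (intro Min_in) auto
  then have lower: "v $ j \<le> \<theta>" if "x $ j < 1" for j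
    using exch that by auto
  have "(v $ i - \<theta>) * (y $ i - x $ i) \<le> 0" for i
  proof (cases "v $ i" \<theta> rule: linorder_cases)
    case less
    then have "x $ i = 0" using upper[of i] x[of i] by linarith
    then show ?thesis using less y[of i] by (simp add: mult_le_0_iff)
  next
    case greater
    then have "x $ i = 1" using lower[of i] x[of i] by linarith
    then show ?thesis using greater y[of i] by (simp add: mult_le_0_iff)
  qed simp
  then have "(\<Sum>i\<in>UNIV. (v $ i - \<theta>) * (y $ i - x $ i)) \<le> 0"
    by (simp add: sum_nonpos)
  moreover have "(\<Sum>i\<in>UNIV. (v $ i - \<theta>) * (y $ i - x $ i)) =
      (\<Sum>i\<in>UNIV. v $ i * y $ i) - (\<Sum>i\<in>UNIV. v $ i * x $ i)
      - \<theta> * ((\<Sum>i\<in>UNIV. y $ i) - (\<Sum>i\<in>UNIV. x $ i))"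
    by (simp add: algebra_simps sum.distrib sum_subtractf sum_distrib_left)
  ultimately show ?thesis by (simp add: sum_eq)
qed

text \<open>Sorting indices instead of values settles ties, so the first \<open>K\<close> positions
  form a set of exactly \<open>K\<close> indices.\<close>

lemma top_selection:
  fixes v :: "real ^ 'i::finite"
  assumes "K \<le> CARD('i)"
  obtains S :: "'i set" where "card S = K" "(\<Sum>i\<in>S. v $ i) = (\<Sum>k=1..K. kth_largest v k)"
    "\<And>i j. i \<in> S \<Longrightarrow> j \<notin> S \<Longrightarrow> v $ j \<le> v $ i"
proof -
  obtain ys :: "'i list" where ys: "set ys = UNIV" "distinct ys"
    using finite_distinct_list[OF finite] by blast
  define xs where "xs = sort_key (\<lambda>i. - v $ i) ys"
  have xs: "set xs = UNIV" "distinct xs" by (simp_all add: xs_def ys)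
  have len: "length xs = CARD('i)" using xs distinct_card by fastforce
  have "sorted (map (\<lambda>i. - v $ i) xs)" by (simp add: xs_def)
  then have mono: "v $ (xs ! q) \<le> v $ (xs ! p)" if "p \<le> q" "q < length xs" for p q
    using that by (auto simp: sorted_iff_nth_mono)
  have "sorted (rev (map (\<lambda>i. v $ i) xs))"
    using mono by (auto simp: sorted_rev_iff_nth_mono)
  moreover have "mset_set (UNIV :: 'i set) = mset xs"
    using mset_set_set[OF xs(2)] xs(1) by simp
  then have "image_mset (\<lambda>i. v $ i) (mset_set UNIV) = mset (rev (map (\<lambda>i. v $ i) xs))"
    by simp
  ultimately have *:
    "sorted_list_of_multiset (image_mset (\<lambda>i. v $ i) (mset_set UNIV)) = rev (map (\<lambda>i. v $ i) xs)"
    by (metis sorted_list_of_multiset_mset sorted_sort_id)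
  have kth: "kth_largest v k = v $ (xs ! (k - 1))" if "k \<in> {1..K}" for k
  proof -
    have "k - 1 < length xs" using that assms len by auto
    then show ?thesis
      using nth_map[of "k - 1" xs "\<lambda>i. v $ i"] * by (simp add: kth_largest_def)
  qed
  define S where "S = (\<lambda>p. xs ! p) ` {..<K}"
  have inj: "inj_on (\<lambda>p. xs ! p) {..<K}"
    using xs assms len by (auto simp: inj_on_def nth_eq_iff_index_eq)
  show ?thesis
  proof (rule that[of S])
    show "card S = K" unfolding S_def using inj by (simp add: card_image)
    have "(\<Sum>i\<in>S. v $ i) = (\<Sum>p<K. v $ (xs ! p))"
      unfolding S_def using inj by (simp add: sum.reindex)
    also have "\<dots> = (\<Sum>k=1..K. v $ (xs ! (k - 1)))"
      by (rule sum.reindex_bij_witness[of _ "\<lambda>k. k - 1" Suc]) auto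
    finally show "(\<Sum>i\<in>S. v $ i) = (\<Sum>k=1..K. kth_largest v k)"
      by (simp add: kth)
  next
    fix i j assume "i \<in> S" "j \<notin> S"
    obtain p where p: "p < K" "i = xs ! p" using \<open>i \<in> S\<close> by (auto simp: S_def)
    obtain q where q: "q < length xs" "j = xs ! q" using xs(1) by (metis UNIV_I in_set_conv_nth)
    have "K \<le> q" using q \<open>j \<notin> S\<close> by (auto simp: S_def not_le[symmetric])
    then show "v $ j \<le> v $ i" using mono[of p q] p q by simp
  qed
qed

lemma sum_times_indicator:
  fixes v :: "real ^ 'i::finite"
  shows "(\<Sum>i\<in>UNIV. v $ i * of_bool (i \<in> S)) = (\<Sum>i\<in>S. v $ i)"
  by (simp add: of_bool_def if_distrib sum.If_cases cong: if_cong)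

lemma top_sum_attained:
  fixes v :: "real ^ 'i::finite"
  assumes "K \<le> CARD('i)"
  obtains x :: "real ^ 'i" where "\<And>i. x $ i \<in> {0, 1}" "(\<Sum>i\<in>UNIV. x $ i) = real K"
    "(\<Sum>i\<in>UNIV. v $ i * x $ i) = (\<Sum>k=1..K. kth_largest v k)"
    "\<And>i j. 0 < x $ i \<Longrightarrow> x $ j < 1 \<Longrightarrow> v $ j \<le> v $ i"
proof -
  obtain S :: "'i set" where S: "card S = K" "(\<Sum>i\<in>S. v $ i) = (\<Sum>k=1..K. kth_largest v k)"
    "\<And>i j. i \<in> S \<Longrightarrow> j \<notin> S \<Longrightarrow> v $ j \<le> v $ i"
    using top_selection[OF assms, of v] by blast
  show ?thesis
  proof (rule that[of "\<chi> i. of_bool (i \<in> S)"])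
    show "(\<Sum>i\<in>UNIV. ((\<chi> i. of_bool (i \<in> S)) :: real ^ 'i) $ i) = real K"
      using S(1) sum_times_indicator[of "\<chi> i. 1" S] by simp
    show "(\<Sum>i\<in>UNIV. v $ i * (\<chi> i. of_bool (i \<in> S)) $ i) = (\<Sum>k=1..K. kth_largest v k)"
      using S(2) sum_times_indicator[of v S] by simp
  qed (auto intro: S(3))
qed

text \<open>Both parts compare \<open>x\<close> with the 0/1 vector of a top selection through
  \<open>exchange_optimal\<close>, once in each direction.\<close>

lemma
  fixes v x :: "real ^ 'i::finite"
  assumes K: "K \<le> CARD('i)"
    and x: "\<And>i. 0 \<le> x $ i \<and> x $ i \<le> 1" "(\<Sum>i\<in>UNIV. x $ i) = real K"
  shows top_sum_upper: "(\<Sum>i\<in>UNIV. v $ i * x $ i) \<le> (\<Sum>k=1..K. kth_largest v k)"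
    and top_sum_eq: "(\<And>i j. 0 < x $ i \<Longrightarrow> x $ j < 1 \<Longrightarrow> v $ j \<le> v $ i) \<Longrightarrow>
      (\<Sum>i\<in>UNIV. v $ i * x $ i) = (\<Sum>k=1..K. kth_largest v k)"
proof -
  obtain y :: "real ^ 'i" where y: "\<And>i. y $ i \<in> {0, 1}" "(\<Sum>i\<in>UNIV. y $ i) = real K"
    "(\<Sum>i\<in>UNIV. v $ i * y $ i) = (\<Sum>k=1..K. kth_largest v k)"
    "\<And>i j. 0 < y $ i \<Longrightarrow> y $ j < 1 \<Longrightarrow> v $ j \<le> v $ i"
    using top_sum_attained[OF K, of v] by blast
  have y01: "0 \<le> y $ i \<and> y $ i \<le> 1" for i using y(1)[of i] by auto
  show le: "(\<Sum>i\<in>UNIV. v $ i * x $ i) \<le> (\<Sum>k=1..K. kth_largest v k)"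
    using exchange_optimal[of y x v] y01 x y by simp
  assume "\<And>i j. 0 < x $ i \<Longrightarrow> x $ j < 1 \<Longrightarrow> v $ j \<le> v $ i"
  then show "(\<Sum>i\<in>UNIV. v $ i * x $ i) = (\<Sum>k=1..K. kth_largest v k)"
    using exchange_optimal[of x y v] y01 x y le by fastforce
qed

subsection \<open>Potentials in digraphs without positive cycles\<close>

fun path_weight :: "('a \<Rightarrow> 'a \<Rightarrow> real) \<Rightarrow> 'a list \<Rightarrow> real" where
  "path_weight w (a # b # p) = w a b + path_weight w (b # p)"
| "path_weight w _ = 0"

lemma path_weight_append:
  "path_weight w (p @ a # q) = path_weight w (p @ [a]) + path_weight w (a # q)"
  by (induction p rule: induct_list012) auto

lemma path_weight_conv_sum:
  "path_weight w p = (\<Sum>k<length p - 1. w (p ! k) (p ! Suc k))"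
proof (induction w p rule: path_weight.induct)
  case (1 w a b p)
  then show ?case by (simp add: sum.lessThan_Suc_shift del: sum.lessThan_Suc)
qed auto

text \<open>
  In a digraph without a cycle of positive weight, the largest weight of a simple path ending in
  a vertex is a potential. The hypothesis
  is stated for bijections \<open>\<sigma>\<close> of \<open>C\<close>, i.e. for disjoint unions of simple cycles.
\<close>

lemma potential_exists:
  fixes w :: "'g::finite \<Rightarrow> 'g \<Rightarrow> real" and E :: "'g \<Rightarrow> 'g \<Rightarrow> bool"
  assumes no_cycle: "\<And>C \<sigma>. bij_betw \<sigma> C C \<Longrightarrow> (\<And>g. g \<in> C \<Longrightarrow> E g (\<sigma> g)) \<Longrightarrow>
      (\<Sum>g\<in>C. w g (\<sigma> g)) \<le> 0"
  shows "\<exists>\<mu>. \<forall>g h. E g h \<longrightarrow> \<mu> g + w g h \<le> \<mu> h"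
proof -
  define paths where
    "paths h = {p. distinct p \<and> successively E p \<and> p \<noteq> [] \<and> last p = h}" for h
  define \<mu> where "\<mu> h = Max (path_weight w ` paths h)" for h
  have fin: "finite (paths h)" for h
    using finite_subset_distinct[of "UNIV :: 'g set"] by (rule finite_subset[rotated]) (auto simp: paths_def)
  have ne: "paths h \<noteq> {}" for h
  proof -
    have "[h] \<in> paths h" by (simp add: paths_def)
    then show ?thesis by blast
  qed
  have ge: "path_weight w p \<le> \<mu> h" if "p \<in> paths h" for p h
    unfolding \<mu>_def using that fin by (intro Max_ge) auto
  have att: "\<exists>p\<in>paths h. path_weight w p = \<mu> h" for h
    using Max_in[of "path_weight w ` paths h"] fin[of h] ne[of h] unfolding \<mu>_def by fastforce
  \<comment> \<open>A simple path closed by an arc becomes a bijection of its vertices, the form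
    that \<open>no_cycle\<close> requires.\<close>
  have cyc: "path_weight w c + w (last c) (hd c) \<le> 0"
    if c: "distinct c" "successively E c" "c \<noteq> []" "E (last c) (hd c)" for c
  proof -
    define n where "n = length c"
    have n: "n > 0" using c by (simp add: n_def)
    \<comment> \<open>Cyclic successor of positions; the last one wraps to 0 and carries the closing
      arc.\<close>
    define s where "s k = (if Suc k = n then 0 else Suc k)" for k
    define \<sigma> where "\<sigma> = (\<lambda>g. c ! s (the_inv_into {..<n} (\<lambda>k. c ! k) g))"
    have inj: "inj_on (\<lambda>k. c ! k) {..<n}"
      using c(1) by (auto simp: inj_on_def n_def nth_eq_iff_index_eq)
    have im: "(\<lambda>k. c ! k) ` {..<n} = set c" by (auto simp: set_conv_nth n_def)
    have \<sigma>: "\<sigma> (c ! k) = c ! s k" if "k < n" for k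
      using the_inv_into_f_f[OF inj, of k] that by (simp add: \<sigma>_def)
    have s_less: "s k < n" if "k < n" for k using that by (auto simp: s_def)
    have "inj_on \<sigma> (set c)"
    proof (rule inj_onI)
      fix a b assume ab: "a \<in> set c" "b \<in> set c" "\<sigma> a = \<sigma> b"
      obtain k l where kl: "k < n" "l < n" "a = c ! k" "b = c ! l"
        using ab(1,2) unfolding im[symmetric] by blast
      then have "s k = s l" using ab(3) s_less c(1) by (simp add: \<sigma> nth_eq_iff_index_eq n_def)
      then have "k = l" by (simp add: s_def split: if_splits)
      then show "a = b" using kl by simp
    qed
    moreover have "\<sigma> ` set c \<subseteq> set c"
      using s_less \<sigma> by (auto simp: im[symmetric])
    ultimately have bij: "bij_betw \<sigma> (set c) (set c)"
      by (simp add: bij_betw_def endo_inj_surj)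
    have arcs: "E (c ! k) (c ! s k)" if "k < n" for k
    proof (cases "Suc k = n")
      case True
      then have "k = length c - 1" by (simp add: n_def)
      moreover have "s k = 0" using True by (simp add: s_def)
      ultimately show ?thesis using c by (simp add: last_conv_nth hd_conv_nth)
    next
      case False
      then show ?thesis using that c(2) by (simp add: s_def n_def successively_conv_nth)
    qed
    have "(\<Sum>g\<in>set c. w g (\<sigma> g)) = (\<Sum>k<n. w (c ! k) (c ! s k))"
      by (simp add: im[symmetric] sum.reindex[OF inj] \<sigma>)
    also have "{..<n} = insert (n - 1) {..<n - 1}" using n by auto
    also have "(\<Sum>k\<in>insert (n - 1) {..<n - 1}. w (c ! k) (c ! s k))
        = w (c ! (n - 1)) (c ! s (n - 1)) + (\<Sum>k<n - 1. w (c ! k) (c ! s k))"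
      by simp
    also have "(\<Sum>k<n - 1. w (c ! k) (c ! s k)) = path_weight w c"
      unfolding path_weight_conv_sum n_def[symmetric] by (intro sum.cong) (auto simp: s_def)
    also have "w (c ! (n - 1)) (c ! s (n - 1)) = w (last c) (hd c)"
      using n c(3) by (simp add: s_def n_def last_conv_nth hd_conv_nth)
    finally show ?thesis
      using no_cycle[OF bij] arcs \<sigma> by (fastforce simp: im[symmetric])
  qed
  have "\<mu> g + w g h \<le> \<mu> h" if gh: "E g h" for g h
  proof -
    obtain p where p: "p \<in> paths g" "path_weight w p = \<mu> g" using att by blast
    have pp: "distinct p" "successively E p" "p \<noteq> []" "last p = g" using p by (auto simp: paths_def)
    obtain p' where p': "p = p' @ [g]" using pp by (metis append_butlast_last_id)
    show ?thesis
    proof (cases "h \<in> set p")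
      case False
      then have "p @ [h] \<in> paths h"
        using pp gh by (auto simp: paths_def successively_append_iff)
      moreover have "path_weight w (p @ [h]) = path_weight w p + w g h"
        using path_weight_append[of w p' g "[h]"] p' by simp
      ultimately show ?thesis using ge p(2) by metis
    next
      case True
      \<comment> \<open>The part of \<open>p\<close> from \<open>h\<close> to \<open>g\<close>
        closes to a cycle of weight at most 0, so the prefix ending in \<open>h\<close> weighs at
        least \<open>\<mu> g + w g h\<close>.\<close>
      then obtain q c where qc: "p = q @ h # c" by (meson split_list)
      have "q @ [h] \<in> paths h" using pp qc by (auto simp: paths_def successively_append_iff)
      then have "path_weight w (q @ [h]) \<le> \<mu> h" by (rule ge)
      moreover have "path_weight w (h # c) + w (last (h # c)) (hd (h # c)) \<le> 0"
        using pp qc gh by (intro cyc) (auto simp: successively_append_iff)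
      moreover have "last (h # c) = g" using pp qc by auto
      ultimately show ?thesis using path_weight_append[of w q h c] p(2) qc by simp
    qed
  qed
  then show ?thesis by blast
qed

subsection \<open>Weak duality and complementary slackness\<close>

text \<open>Scores and thresholds stay outside the locale because the infeasible case applies its
  lemmas to an auxiliary problem with other ones.\<close>

locale grouped_items =
  fixes Ig :: "'g::finite \<Rightarrow> 'i::finite set" and T K :: nat
  assumes groups: "\<forall>i. \<exists>!g. i \<in> Ig g" and K: "K \<le> CARD('i)"
begin

section \<open>Groups, exposures and relaxed decisions\<close>

definition grp :: "'i \<Rightarrow> 'g" where
  "grp i = (THE g. i \<in> Ig g)"

lemma mem_Ig: "i \<in> Ig g \<longleftrightarrow> grp i = g"
  using groups theI'[of "\<lambda>g. i \<in> Ig g"] unfolding grp_def by blast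

lemma adjacency_mult: "(adjacency Ig *v \<mu>) $ i = \<mu> $ grp i"
  by (simp add: matrix_vector_mult_def adjacency_def mem_Ig if_distrib[of "\<lambda>a. a * _"] cong: if_cong)

lemma exposure_conv_sum: "exposure T Ig x g = (\<Sum>t=1..T. \<Sum>i\<in>UNIV. x t $ i * of_bool (grp i = g))"
  unfolding exposure_def
proof (rule sum.cong[OF refl])
  fix t
  show "(\<Sum>i\<in>Ig g. x t $ i) = (\<Sum>i\<in>UNIV. x t $ i * of_bool (grp i = g))"
    using sum_times_indicator[of "x t" "Ig g"] by (simp add: mem_Ig)
qed

text \<open>Exchanging the sums carries weights from groups to items: multipliers here become prices
  of items, and the constant weight 1 gives the total exposure.\<close>

lemma sum_mult_exposure:
  "(\<Sum>g\<in>UNIV. c g * exposure T Ig x g) = (\<Sum>t=1..T. \<Sum>i\<in>UNIV. c (grp i) * x t $ i)"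
proof -
  have "(\<Sum>g\<in>UNIV. c g * exposure T Ig x g)
      = (\<Sum>g\<in>UNIV. \<Sum>t=1..T. \<Sum>i\<in>UNIV. x t $ i * (c g * of_bool (grp i = g)))"
    unfolding exposure_conv_sum sum_distrib_left by (intro sum.cong refl) simp
  also have "\<dots> = (\<Sum>t=1..T. \<Sum>g\<in>UNIV. \<Sum>i\<in>UNIV. x t $ i * (c g * of_bool (grp i = g)))"
    by (rule sum.swap)
  also have "\<dots> = (\<Sum>t=1..T. \<Sum>i\<in>UNIV. \<Sum>g\<in>UNIV. x t $ i * (c g * of_bool (grp i = g)))"
    by (intro sum.cong refl) (rule sum.swap)
  also have "\<dots> = (\<Sum>t=1..T. \<Sum>i\<in>UNIV. c (grp i) * x t $ i)"
  proof (intro sum.cong refl)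
    fix t i
    have "(\<Sum>g\<in>UNIV. x t $ i * (c g * of_bool (grp i = g)))
        = (\<Sum>g\<in>UNIV. if grp i = g then c g * x t $ i else 0)"
      by (intro sum.cong) auto
    then show "(\<Sum>g\<in>UNIV. x t $ i * (c g * of_bool (grp i = g))) = c (grp i) * x t $ i"
      by simp
  qed
  finally show ?thesis .
qed

text \<open>The entry set \<open>B\<close> is a parameter so that one argument covers the integral
  problem, \<open>{0, 1}\<close>, and its linear relaxation, \<open>{0..1}\<close>.\<close>

definition relaxed_decisions :: "real set \<Rightarrow> (nat \<Rightarrow> real ^ 'i) set" where
  "relaxed_decisions B = {x. \<forall>t\<in>{1..T}. (\<forall>i. x t $ i \<in> B) \<and> (\<Sum>i\<in>UNIV. x t $ i) = real K}"

definition relaxed_feasible :: "real set \<Rightarrow> real ^ 'g \<Rightarrow> (nat \<Rightarrow> real ^ 'i) set" where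
  "relaxed_feasible B m = {x \<in> relaxed_decisions B. \<forall>g. m $ g \<le> exposure T Ig x g}"

lemma decisions_conv_relaxed: "decisions T K = relaxed_decisions {0, 1}"
  by (simp add: decisions_def relaxed_decisions_def)

lemma primal_feasible_conv_relaxed: "primal_feasible T K Ig m = relaxed_feasible {0, 1} m"
  by (simp add: primal_feasible_def relaxed_feasible_def decisions_conv_relaxed)

lemma relaxed_decisions_mono: "B \<subseteq> C \<Longrightarrow> relaxed_decisions B \<subseteq> relaxed_decisions C"
  by (auto simp: relaxed_decisions_def)

lemma decisions_subset_relaxed: "decisions T K \<subseteq> relaxed_decisions {0..1}"
  unfolding decisions_conv_relaxed by (intro relaxed_decisions_mono) auto

lemma sum_exposure:
  assumes "x \<in> relaxed_decisions B"
  shows "(\<Sum>g\<in>UNIV. exposure T Ig x g) = real T * real K"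
proof -
  have "(\<Sum>g\<in>UNIV. exposure T Ig x g) = (\<Sum>t=1..T. \<Sum>i\<in>UNIV. x t $ i)"
    using sum_mult_exposure[of "\<lambda>_. 1" x] by simp
  also have "\<dots> = (\<Sum>t=1..T. real K)"
    using assms by (intro sum.cong) (auto simp: relaxed_decisions_def)
  finally show ?thesis by simp
qed

lemma lagrangian_conv_objective:
  "lagrangian T r Ig \<mu> x e =
     primal_objective T r x + (\<Sum>g\<in>UNIV. \<mu> $ g * (e $ g - exposure T Ig x g))"
  using sum_mult_exposure[of "\<lambda>g. \<mu> $ g" x]
  by (simp add: lagrangian_def primal_objective_def adjacency_mult algebra_simps sum_subtractf)

text \<open>Each list is bounded by its top sum. The surplus \<open>e - m\<close> is nonnegative
  with fixed total, so weighting it by \<open>\<mu>\<close> gives at most the largest multiplier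
  times that total.\<close>

lemma lagrangian_le_dual_objective:
  assumes x: "x \<in> relaxed_decisions {0..1}" and e: "e \<in> exposure_vectors T K m"
  shows "lagrangian T r Ig \<mu> x e \<le> dual_objective T K r Ig m \<mu>"
proof -
  have "(\<Sum>i\<in>UNIV. (r t $ i - (adjacency Ig *v \<mu>) $ i) * x t $ i)
      \<le> (\<Sum>k=1..K. kth_largest (r t - adjacency Ig *v \<mu>) k)" if "t \<in> {1..T}" for t
    using top_sum_upper[OF K, of "x t" "r t - adjacency Ig *v \<mu>"] x that
    by (simp add: relaxed_decisions_def)
  then have "(\<Sum>t=1..T. \<Sum>i\<in>UNIV. (r t $ i - (adjacency Ig *v \<mu>) $ i) * x t $ i)
      \<le> (\<Sum>t=1..T. \<Sum>k=1..K. kth_largest (r t - adjacency Ig *v \<mu>) k)"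
    by (rule sum_mono)
  moreover have "(\<Sum>g\<in>UNIV. \<mu> $ g * (e $ g - m $ g))
      \<le> (\<Sum>g\<in>UNIV. Max (range (\<lambda>g. \<mu> $ g)) * (e $ g - m $ g))"
    using e by (intro sum_mono mult_right_mono) (auto simp: exposure_vectors_def)
  then have "(\<Sum>g\<in>UNIV. \<mu> $ g * e $ g)
      \<le> (\<Sum>g\<in>UNIV. m $ g * \<mu> $ g)
        + Max (range (\<lambda>g. \<mu> $ g)) * (real T * real K - (\<Sum>g\<in>UNIV. m $ g))"
    using e by (simp add: exposure_vectors_def algebra_simps sum_subtractf
        sum_distrib_left[symmetric] sum_distrib_right[symmetric])
  ultimately show ?thesis by (simp add: lagrangian_def dual_objective_def)
qed

lemma lagrangian_attains_dual_objective:
  assumes m: "(\<Sum>g\<in>UNIV. m $ g) \<le> real T * real K"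
  shows "\<exists>x\<in>decisions T K. \<exists>e\<in>exposure_vectors T K m.
    lagrangian T r Ig \<mu> x e = dual_objective T K r Ig m \<mu>"
proof -
  have "\<exists>y :: real ^ 'i. (\<forall>i. y $ i \<in> {0, 1}) \<and> (\<Sum>i\<in>UNIV. y $ i) = real K \<and>
      (\<Sum>i\<in>UNIV. (r t - adjacency Ig *v \<mu>) $ i * y $ i)
        = (\<Sum>k=1..K. kth_largest (r t - adjacency Ig *v \<mu>) k)" for t
    using top_sum_attained[OF K, of "r t - adjacency Ig *v \<mu>"] by metis
  then have "\<forall>t. \<exists>y :: real ^ 'i. (\<forall>i. y $ i \<in> {0, 1}) \<and> (\<Sum>i\<in>UNIV. y $ i) = real K \<and>
      (\<Sum>i\<in>UNIV. (r t - adjacency Ig *v \<mu>) $ i * y $ i)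
        = (\<Sum>k=1..K. kth_largest (r t - adjacency Ig *v \<mu>) k)" ..
  from choice[OF this] obtain x :: "nat \<Rightarrow> real ^ 'i" where x:
    "\<And>t i. x t $ i \<in> {0, 1}" "\<And>t. (\<Sum>i\<in>UNIV. x t $ i) = real K"
    "\<And>t. (\<Sum>i\<in>UNIV. (r t - adjacency Ig *v \<mu>) $ i * x t $ i)
        = (\<Sum>k=1..K. kth_largest (r t - adjacency Ig *v \<mu>) k)"
    by blast
  have "Max (range (\<lambda>g. \<mu> $ g)) \<in> range (\<lambda>g. \<mu> $ g)" by (intro Max_in) auto
  then obtain h where h: "Max (range (\<lambda>g. \<mu> $ g)) = \<mu> $ h" by blast
  \<comment> \<open>All surplus goes to one group with the largest multiplier; the assumption
    \<open>m\<close> keeps it nonnegative.\<close>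
  define e :: "real ^ 'g" where
    "e = (\<chi> g. m $ g + of_bool (g = h) * (real T * real K - (\<Sum>g\<in>UNIV. m $ g)))"
  have delta: "(\<Sum>g\<in>UNIV. of_bool (g = h) * c g) = (c h :: real)" for c
    by (simp add: of_bool_def if_distrib[of "\<lambda>a. a * _"] cong: if_cong)
  have "e \<in> exposure_vectors T K m"
    using m delta by (simp add: exposure_vectors_def e_def sum.distrib)
  moreover have "x \<in> decisions T K" using x by (simp add: decisions_def)
  moreover have "(\<Sum>g\<in>UNIV. \<mu> $ g * e $ g) = (\<Sum>g\<in>UNIV. m $ g * \<mu> $ g)
        + Max (range (\<lambda>g. \<mu> $ g)) * (real T * real K - (\<Sum>g\<in>UNIV. m $ g))"
    using delta[of "\<lambda>g. \<mu> $ g * (real T * real K - (\<Sum>g\<in>UNIV. m $ g))"]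
    by (simp add: e_def h distrib_left sum.distrib mult.commute mult.left_commute)
  then have "lagrangian T r Ig \<mu> x e = dual_objective T K r Ig m \<mu>"
    using x(3) by (simp add: lagrangian_def dual_objective_def)
  ultimately show ?thesis by blast
qed

text \<open>With the exposure of \<open>x\<close> as \<open>e\<close>, the linking term of the
  Lagrangian vanishes. Covering fractional \<open>x\<close> lets an optimum of the relaxation
  certify a dual minimum.\<close>

lemma weak_duality:
  assumes "x \<in> relaxed_feasible {0..1} m"
  shows "primal_objective T r x \<le> dual_objective T K r Ig m \<mu>"
proof -
  have x: "x \<in> relaxed_decisions {0..1}" "\<And>g. m $ g \<le> exposure T Ig x g"
    using assms by (simp_all add: relaxed_feasible_def)
  then have "(\<chi> g. exposure T Ig x g) \<in> exposure_vectors T K m"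
    by (simp add: exposure_vectors_def sum_exposure)
  from lagrangian_le_dual_objective[OF x(1) this, of r \<mu>] show ?thesis
    by (simp add: lagrangian_conv_objective)
qed

text \<open>By \<open>exch\<close> every list is optimal for the scores reduced by
  \<open>\<mu>\<close>, and by \<open>slack\<close> surplus occurs only in groups of largest
  multiplier, so both estimates behind weak duality are tight.\<close>

lemma complementary_slackness:
  assumes x: "x \<in> relaxed_decisions {0..1}"
    and exch: "\<And>t i j. t \<in> {1..T} \<Longrightarrow> 0 < x t $ i \<Longrightarrow> x t $ j < 1 \<Longrightarrow>
        r t $ j - \<mu> $ grp j \<le> r t $ i - \<mu> $ grp i"
    and slack: "\<And>g h. exposure T Ig x g \<noteq> m $ g \<Longrightarrow> \<mu> $ h \<le> \<mu> $ g"
  shows "dual_objective T K r Ig m \<mu> = primal_objective T r x"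
proof -
  define M where "M = Max (range (\<lambda>g. \<mu> $ g))"
  have "(\<Sum>i\<in>UNIV. (r t - adjacency Ig *v \<mu>) $ i * x t $ i)
      = (\<Sum>k=1..K. kth_largest (r t - adjacency Ig *v \<mu>) k)" if "t \<in> {1..T}" for t
    using x that exch by (intro top_sum_eq[OF K])
      (auto simp: relaxed_decisions_def adjacency_mult)
  then have top: "(\<Sum>t=1..T. \<Sum>k=1..K. kth_largest (r t - adjacency Ig *v \<mu>) k)
      = (\<Sum>t=1..T. \<Sum>i\<in>UNIV. (r t $ i - (adjacency Ig *v \<mu>) $ i) * x t $ i)"
    by simp
  have "\<mu> $ g = M" if "exposure T Ig x g \<noteq> m $ g" for g
    unfolding M_def using slack[OF that] by (intro Max_eqI[symmetric]) auto
  then have "\<mu> $ g * (exposure T Ig x g - m $ g) = M * (exposure T Ig x g - m $ g)" for g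
    by (cases "exposure T Ig x g = m $ g") simp_all
  then have "(\<Sum>g\<in>UNIV. \<mu> $ g * (exposure T Ig x g - m $ g))
      = M * (\<Sum>g\<in>UNIV. exposure T Ig x g - m $ g)"
    unfolding sum_distrib_left by (rule sum.cong[OF refl])
  also have "\<dots> = M * (real T * real K - (\<Sum>g\<in>UNIV. m $ g))"
    by (simp add: sum_subtractf sum_exposure[OF x])
  finally have "(\<Sum>g\<in>UNIV. \<mu> $ g * exposure T Ig x g)
      = (\<Sum>g\<in>UNIV. m $ g * \<mu> $ g) + M * (real T * real K - (\<Sum>g\<in>UNIV. m $ g))"
    by (simp add: right_diff_distrib sum_subtractf mult.commute)
  then have "dual_objective T K r Ig m \<mu> = lagrangian T r Ig \<mu> x (\<chi> g. exposure T Ig x g)"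
    unfolding dual_objective_def lagrangian_def top M_def[symmetric] by simp
  then show ?thesis by (simp add: lagrangian_conv_objective)
qed

subsection \<open>The exchange digraph of an optimum\<close>

text \<open>A set of weights encodes parallel arcs; the empty set means no arc. A swap drops an item
  of \<open>g\<close> and adds one of \<open>h\<close>. The element 0 lets \<open>h\<close> pass
  exposure on without receiving any, out of its surplus.\<close>

definition gains :: "(nat \<Rightarrow> real ^ 'i) \<Rightarrow> real ^ 'g \<Rightarrow> (nat \<Rightarrow> real ^ 'i) \<Rightarrow> 'g \<Rightarrow> 'g \<Rightarrow> real set" where
  "gains r m x g h =
     {r t $ j - r t $ i | t i j. t \<in> {1..T} \<and> 0 < x t $ i \<and> x t $ j < 1 \<and> grp i = g \<and> grp j = h}
     \<union> (if m $ h < exposure T Ig x h then {0} else {})"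

lemma finite_gains: "finite (gains r m x g h)"
proof -
  have "gains r m x g h \<subseteq> insert 0 (\<Union>t\<in>{1..T}. \<Union>i. \<Union>j. {r t $ j - r t $ i})"
  proof
    fix c assume "c \<in> gains r m x g h"
    then consider "c = 0" | t i j where "t \<in> {1..T}" "c = r t $ j - r t $ i"
      unfolding gains_def by (auto split: if_splits)
    then show "c \<in> insert 0 (\<Union>t\<in>{1..T}. \<Union>i. \<Union>j. {r t $ j - r t $ i})"
      by cases blast+
  qed
  then show ?thesis by (rule finite_subset) simp
qed

text \<open>Swap \<open>g\<close> adds 1 at \<open>j g\<close> and takes 1 from \<open>i g\<close>
  in list \<open>t g\<close>. The coefficients \<open>f\<close> are arbitrary so that list sizes,
  exposures and the objective are all instances.\<close>

lemma swap_sum: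
  fixes t :: "'a \<Rightarrow> nat" and i j :: "'a \<Rightarrow> 'i" and f :: "nat \<Rightarrow> 'i \<Rightarrow> real"
  assumes t: "\<And>g. g \<in> S \<Longrightarrow> t g \<in> {1..T}"
  shows "(\<Sum>\<tau>=1..T. \<Sum>k\<in>UNIV.
      (\<Sum>g\<in>S. of_bool (t g = \<tau> \<and> j g = k) - of_bool (t g = \<tau> \<and> i g = k)) * f \<tau> k)
    = (\<Sum>g\<in>S. f (t g) (j g) - f (t g) (i g))"
proof -
  have single: "(\<Sum>\<tau>=1..T. \<Sum>k\<in>UNIV. of_bool (s = \<tau> \<and> l = k) * f \<tau> k) = f s l"
    if "s \<in> {1..T}" for s l
  proof -
    have "(\<Sum>k\<in>UNIV. of_bool (s = \<tau> \<and> l = k) * f \<tau> k) = (if s = \<tau> then f s l else 0)" for \<tau>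
    proof -
      have "(\<Sum>k\<in>UNIV. of_bool (s = \<tau> \<and> l = k) * f \<tau> k)
          = (\<Sum>k\<in>UNIV. if l = k then (if s = \<tau> then f s k else 0) else 0)"
        by (intro sum.cong) auto
      then show ?thesis by simp
    qed
    then show ?thesis using that by simp
  qed
  have "(\<Sum>\<tau>=1..T. \<Sum>k\<in>UNIV.
      (\<Sum>g\<in>S. of_bool (t g = \<tau> \<and> j g = k) - of_bool (t g = \<tau> \<and> i g = k)) * f \<tau> k)
    = (\<Sum>\<tau>=1..T. \<Sum>k\<in>UNIV. \<Sum>g\<in>S.
        of_bool (t g = \<tau> \<and> j g = k) * f \<tau> k - of_bool (t g = \<tau> \<and> i g = k) * f \<tau> k)"
    unfolding sum_distrib_right left_diff_distrib ..
  also have "\<dots> = (\<Sum>\<tau>=1..T. \<Sum>g\<in>S. \<Sum>k\<in>UNIV.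
        of_bool (t g = \<tau> \<and> j g = k) * f \<tau> k - of_bool (t g = \<tau> \<and> i g = k) * f \<tau> k)"
    by (intro sum.cong refl) (rule sum.swap)
  also have "\<dots> = (\<Sum>g\<in>S. \<Sum>\<tau>=1..T. \<Sum>k\<in>UNIV.
        of_bool (t g = \<tau> \<and> j g = k) * f \<tau> k - of_bool (t g = \<tau> \<and> i g = k) * f \<tau> k)"
    by (rule sum.swap)
  also have "\<dots> = (\<Sum>g\<in>S. f (t g) (j g) - f (t g) (i g))"
    unfolding sum_subtractf by (intro arg_cong2[where f = "(-)"] sum.cong refl single t)
  finally show ?thesis .
qed

lemma sum_of_bool_unique:
  assumes "finite S" "\<And>g h. g \<in> S \<Longrightarrow> h \<in> S \<Longrightarrow> P g \<Longrightarrow> P h \<Longrightarrow> g = h"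
  shows "(\<Sum>g\<in>S. of_bool (P g)) = (of_bool (\<exists>g\<in>S. P g) :: real)"
proof (cases "\<exists>g\<in>S. P g")
  case True
  then obtain g where g: "g \<in> S" "P g" by blast
  then have "(\<Sum>h\<in>S. of_bool (P h)) = (\<Sum>h\<in>S. if g = h then 1 else 0 :: real)"
    using assms(2) by (intro sum.cong) auto
  then show ?thesis using g assms(1) by auto
qed simp

text \<open>All swaps along the cycles are made at once with step \<open>\<delta>\<close>. The
  result is feasible, and its objective differs from that of \<open>x\<close> by
  \<open>\<delta>\<close> times the total weight.\<close>

lemma cycle_gain_nonpos:
  assumes B: "B \<subseteq> {0..1}"
    and x: "x \<in> relaxed_feasible B m"
    and opt: "\<And>y. y \<in> relaxed_feasible B m \<Longrightarrow> primal_objective T r y \<le> primal_objective T r x"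
    and \<delta>: "0 < \<delta>"
    and down: "\<And>t i. t \<in> {1..T} \<Longrightarrow> 0 < x t $ i \<Longrightarrow> x t $ i - \<delta> \<in> B"
    and up: "\<And>t i. t \<in> {1..T} \<Longrightarrow> x t $ i < 1 \<Longrightarrow> x t $ i + \<delta> \<in> B"
    and slack: "\<And>g. m $ g < exposure T Ig x g \<Longrightarrow> m $ g \<le> exposure T Ig x g - \<delta>"
    and \<sigma>: "bij_betw \<sigma> C C"
    and w: "\<And>g. g \<in> C \<Longrightarrow> w g \<in> gains r m x g (\<sigma> g)"
  shows "(\<Sum>g\<in>C. w g) \<le> 0"
proof -
  define sw where "sw g t i j \<longleftrightarrow> t \<in> {1..T} \<and> 0 < x t $ i \<and> x t $ j < 1 \<and> grp i = g \<and>
      grp j = \<sigma> g \<and> w g = r t $ j - r t $ i" for g t i j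
  \<comment> \<open>Arcs leaving \<open>S\<close> are realized by swaps; the other arcs have weight
    0 and enter groups with surplus.\<close>
  define S where "S = {g \<in> C. \<exists>t i j. sw g t i j}"
  have "\<exists>t i j. g \<in> S \<longrightarrow> sw g t i j" for g by (auto simp: S_def)
  then obtain t i j where tij: "\<And>g. g \<in> S \<Longrightarrow> sw g (t g) (i g) (j g)" by metis
  have swD: "t g \<in> {1..T}" "0 < x (t g) $ i g" "x (t g) $ j g < 1" "grp (i g) = g"
    "grp (j g) = \<sigma> g" "w g = r (t g) $ j g - r (t g) $ i g" if "g \<in> S" for g
    using tij[OF that] by (simp_all add: sw_def)
  have null: "w g = 0 \<and> m $ \<sigma> g < exposure T Ig x (\<sigma> g)" if "g \<in> C - S" for g
    using w[of g] that unfolding S_def sw_def gains_def by (auto split: if_splits)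
  have SC: "S \<subseteq> C" by (auto simp: S_def)
  have inj: "g = h" if "g \<in> C" "h \<in> C" "\<sigma> g = \<sigma> h" for g h
    using that \<sigma> by (auto simp: bij_betw_def inj_on_def)
  define a where "a \<tau> k = (\<Sum>g\<in>S. of_bool (t g = \<tau> \<and> j g = k) - of_bool (t g = \<tau> \<and> i g = k) :: real)"
    for \<tau> k
  \<comment> \<open>Removed items lie in distinct groups, and so do added ones. Hence at most one
    swap raises a given entry and at most one lowers it.\<close>
  have a_eq: "a \<tau> k = of_bool (\<exists>g\<in>S. t g = \<tau> \<and> j g = k) - of_bool (\<exists>g\<in>S. t g = \<tau> \<and> i g = k)" for \<tau> k
    unfolding a_def sum_subtractf
  proof (intro arg_cong2[where f = "(-)"] sum_of_bool_unique)
    fix g h assume gh: "g \<in> S" "h \<in> S"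
    { assume "t g = \<tau> \<and> j g = k" "t h = \<tau> \<and> j h = k"
      then have "\<sigma> g = \<sigma> h" using gh swD(5) by metis
      then show "g = h" using gh SC inj by blast }
    { assume "t g = \<tau> \<and> i g = k" "t h = \<tau> \<and> i h = k"
      then show "g = h" using gh swD(4) by metis }
  qed simp_all
  define y :: "nat \<Rightarrow> real ^ 'i" where "y \<tau> = (\<chi> k. x \<tau> $ k + \<delta> * a \<tau> k)" for \<tau>
  have total: "(\<Sum>\<tau>=1..T. \<Sum>k\<in>UNIV. y \<tau> $ k * f \<tau> k)
      = (\<Sum>\<tau>=1..T. \<Sum>k\<in>UNIV. x \<tau> $ k * f \<tau> k) + \<delta> * (\<Sum>g\<in>S. f (t g) (j g) - f (t g) (i g))" for f
  proof -
    have "(\<Sum>\<tau>=1..T. \<Sum>k\<in>UNIV. y \<tau> $ k * f \<tau> k)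
        = (\<Sum>\<tau>=1..T. \<Sum>k\<in>UNIV. x \<tau> $ k * f \<tau> k) + \<delta> * (\<Sum>\<tau>=1..T. \<Sum>k\<in>UNIV. a \<tau> k * f \<tau> k)"
      by (simp add: y_def distrib_right sum.distrib sum_distrib_left mult.assoc)
    then show ?thesis using swap_sum[of S t j i f] swD(1) unfolding a_def by simp
  qed
  have xB: "x \<tau> $ k \<in> B" if "\<tau> \<in> {1..T}" for \<tau> k
    using x that by (simp add: relaxed_feasible_def relaxed_decisions_def)
  have "y \<tau> $ k \<in> B" if \<tau>: "\<tau> \<in> {1..T}" for \<tau> k
  proof -
    have "x \<tau> $ k < 1" if "\<exists>g\<in>S. t g = \<tau> \<and> j g = k" using that swD(3) by blast
    moreover have "0 < x \<tau> $ k" if "\<exists>g\<in>S. t g = \<tau> \<and> i g = k" using that swD(2) by blast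
    ultimately show ?thesis
      using xB[OF \<tau>, of k] up[OF \<tau>, of k] down[OF \<tau>, of k] by (auto simp: y_def a_eq)
  qed
  moreover have "(\<Sum>k\<in>UNIV. y \<tau> $ k) = real K" if \<tau>: "\<tau> \<in> {1..T}" for \<tau>
  proof -
    \<comment> \<open>The size of a single list is a linear functional too; swaps preserve it, since
      both their items lie in the same list.\<close>
    have pick: "(\<Sum>s=1..T. \<Sum>k\<in>UNIV. z s $ k * of_bool (s = \<tau>)) = (\<Sum>k\<in>UNIV. z \<tau> $ k)"
      for z :: "nat \<Rightarrow> real ^ 'i"
    proof -
      have "(\<Sum>s=1..T. \<Sum>k\<in>UNIV. z s $ k * of_bool (s = \<tau>))
          = (\<Sum>s=1..T. if s = \<tau> then \<Sum>k\<in>UNIV. z s $ k else 0)"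
        by (intro sum.cong) auto
      then show ?thesis using \<tau> by simp
    qed
    show ?thesis
      using total[of "\<lambda>s k. of_bool (s = \<tau>)"] x \<tau> unfolding pick
      by (simp add: relaxed_feasible_def relaxed_decisions_def del: sum_mult_of_bool_eq)
  qed
  moreover have "m $ h \<le> exposure T Ig y h" for h
  proof -
    have "exposure T Ig y h = exposure T Ig x h
        + \<delta> * (\<Sum>g\<in>S. of_bool (\<sigma> g = h) - of_bool (g = h))"
      using total[of "\<lambda>s k. of_bool (grp k = h)"] swD(4,5)
      by (simp add: exposure_conv_sum del: sum_mult_of_bool_eq)
    \<comment> \<open>Along all of \<open>C\<close> every group gains as often as it loses, so a net
      loss at \<open>h\<close> stems from an arc outside \<open>S\<close> that enters
      \<open>h\<close>. There is at most one, and only if \<open>h\<close> has surplus.\<close>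
    moreover have "- of_bool (m $ h < exposure T Ig x h)
        \<le> (\<Sum>g\<in>S. of_bool (\<sigma> g = h) - of_bool (g = h) :: real)"
    proof -
      have "(\<Sum>g\<in>C. of_bool (\<sigma> g = h) - of_bool (g = h) :: real) = 0"
        using sum.reindex_bij_betw[OF \<sigma>, of "\<lambda>g. of_bool (g = h) :: real"]
        by (simp only: sum_subtractf)
      then have "(\<Sum>g\<in>S. of_bool (\<sigma> g = h) - of_bool (g = h) :: real)
          = - (\<Sum>g\<in>C - S. of_bool (\<sigma> g = h) - of_bool (g = h))"
        using sum.subset_diff[OF SC, of "\<lambda>g. of_bool (\<sigma> g = h) - of_bool (g = h) :: real"] by simp
      moreover have "(\<Sum>g\<in>C - S. of_bool (\<sigma> g = h) - of_bool (g = h) :: real)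
          \<le> (\<Sum>g\<in>C - S. of_bool (\<sigma> g = h))"
        by (intro sum_mono) simp
      moreover have "(\<Sum>g\<in>C - S. of_bool (\<sigma> g = h) :: real) = of_bool (\<exists>g\<in>C - S. \<sigma> g = h)"
        using inj by (intro sum_of_bool_unique) auto
      moreover have "of_bool (\<exists>g\<in>C - S. \<sigma> g = h) \<le> (of_bool (m $ h < exposure T Ig x h) :: real)"
        using null by auto
      ultimately show ?thesis by linarith
    qed
    then have "\<delta> * - of_bool (m $ h < exposure T Ig x h)
        \<le> \<delta> * (\<Sum>g\<in>S. of_bool (\<sigma> g = h) - of_bool (g = h))"
      using \<delta> by (intro mult_left_mono) simp_all
    ultimately have "exposure T Ig x h - \<delta> * of_bool (m $ h < exposure T Ig x h) \<le> exposure T Ig y h"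
      by simp
    moreover have "m $ h \<le> exposure T Ig x h" using x by (simp add: relaxed_feasible_def)
    ultimately show ?thesis using slack[of h] by (cases "m $ h < exposure T Ig x h") auto
  qed
  ultimately have "y \<in> relaxed_feasible B m"
    by (simp add: relaxed_feasible_def relaxed_decisions_def)
  then have "primal_objective T r y \<le> primal_objective T r x" by (rule opt)
  moreover have "primal_objective T r y
      = primal_objective T r x + \<delta> * (\<Sum>g\<in>S. r (t g) $ j g - r (t g) $ i g)"
    using total[of "\<lambda>s k. r s $ k"] by (simp add: primal_objective_def)
  ultimately have "(\<Sum>g\<in>S. r (t g) $ j g - r (t g) $ i g) \<le> 0"
    using \<delta> by (simp add: mult_le_0_iff)
  also have "(\<Sum>g\<in>S. r (t g) $ j g - r (t g) $ i g) = (\<Sum>g\<in>S. w g)"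
    using swD(6) by (intro sum.cong) auto
  also have "\<dots> = (\<Sum>g\<in>C. w g)"
    using SC null by (intro sum.mono_neutral_left) auto
  finally show ?thesis .
qed

text \<open>Potentials for the heaviest gain on each arc serve as multipliers: swap arcs yield the
  exchange condition, zero arcs the slackness condition.\<close>

lemma dual_attains_primal_optimum:
  assumes B: "B \<subseteq> {0..1}"
    and x: "x \<in> relaxed_feasible B m"
    and opt: "\<And>y. y \<in> relaxed_feasible B m \<Longrightarrow> primal_objective T r y \<le> primal_objective T r x"
    and \<delta>: "0 < \<delta>"
    and down: "\<And>t i. t \<in> {1..T} \<Longrightarrow> 0 < x t $ i \<Longrightarrow> x t $ i - \<delta> \<in> B"
    and up: "\<And>t i. t \<in> {1..T} \<Longrightarrow> x t $ i < 1 \<Longrightarrow> x t $ i + \<delta> \<in> B"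
    and slack: "\<And>g. m $ g < exposure T Ig x g \<Longrightarrow> m $ g \<le> exposure T Ig x g - \<delta>"
  shows "\<exists>\<mu>. dual_objective T K r Ig m \<mu> = primal_objective T r x"
proof -
  define w where "w g h = Max (gains r m x g h)" for g h
  have w_in: "w g h \<in> gains r m x g h" if "gains r m x g h \<noteq> {}" for g h
    unfolding w_def using finite_gains that by (rule Max_in)
  have w_ge: "c \<le> w g h" if "c \<in> gains r m x g h" for c g h
    unfolding w_def using finite_gains that by (rule Max_ge)
  have "\<exists>\<mu>. \<forall>g h. gains r m x g h \<noteq> {} \<longrightarrow> \<mu> g + w g h \<le> \<mu> h"
    by (intro potential_exists cycle_gain_nonpos[OF B x opt \<delta> down up slack]) (auto intro: w_in)
  then obtain \<nu> where \<nu>: "\<And>g h. gains r m x g h \<noteq> {} \<Longrightarrow> \<nu> g + w g h \<le> \<nu> h" by blast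
  have le: "\<nu> g + c \<le> \<nu> h" if "c \<in> gains r m x g h" for c g h
  proof -
    have "\<nu> g + w g h \<le> \<nu> h" using that by (intro \<nu>) blast
    then show ?thesis using w_ge[OF that] by linarith
  qed
  have "dual_objective T K r Ig m (\<chi> g. \<nu> g) = primal_objective T r x"
  proof (rule complementary_slackness)
    show "x \<in> relaxed_decisions {0..1}"
      using x relaxed_decisions_mono[OF B] by (auto simp: relaxed_feasible_def)
  next
    fix t i j assume "t \<in> {1..T}" "0 < x t $ i" "x t $ j < 1"
    then have "r t $ j - r t $ i \<in> gains r m x (grp i) (grp j)"
      unfolding gains_def by blast
    from le[OF this] show "r t $ j - (\<chi> g. \<nu> g) $ grp j \<le> r t $ i - (\<chi> g. \<nu> g) $ grp i"
      by simp
  next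
    fix g h assume "exposure T Ig x g \<noteq> m $ g"
    moreover have "m $ g \<le> exposure T Ig x g" using x by (simp add: relaxed_feasible_def)
    \<comment> \<open>A group with surplus is entered from every group, so its potential is
      maximal.\<close>
    ultimately have "0 \<in> gains r m x h g" by (simp add: gains_def)
    from le[OF this] show "(\<chi> g. \<nu> g) $ h \<le> (\<chi> g. \<nu> g) $ g" by simp
  qed
  then show ?thesis by blast
qed

subsection \<open>Strong duality\<close>

text \<open>A continuous function attains its maximum on a compact set. Feasibility leaves times
  outside \<open>{1..T}\<close> free, so compactness is gained by confining these to
  \<open>C\<close> as well; resetting them to 0 loses no objective value.\<close>

lemma primal_optimum_exists:
  assumes B: "closed B" "0 \<in> B" "B \<subseteq> {0..1}" and ne: "relaxed_feasible B m \<noteq> {}"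
  obtains x where "x \<in> relaxed_feasible B m"
    "\<And>y. y \<in> relaxed_feasible B m \<Longrightarrow> primal_objective T r y \<le> primal_objective T r x"
proof -
  define C :: "(real ^ 'i) set" where "C = {v. \<forall>i. v $ i \<in> B}"
  have "closed C"
    unfolding C_def
  proof (rule closed_Collect_all)
    show "closed {v :: real ^ 'i. v $ i \<in> B}" for i
      using continuous_closed_vimage[OF B(1), of "\<lambda>v :: real ^ 'i. v $ i"]
      by (simp add: vimage_def)
  qed
  moreover have "C \<subseteq> cbox 0 1" using B(3) by (fastforce simp: C_def mem_box_cart)
  then have "bounded C" using bounded_cbox bounded_subset by blast
  ultimately have C: "compact C" by (simp add: compact_eq_bounded_closed)
  have "compactin (product_topology (\<lambda>_. euclidean) UNIV) (Pi\<^sub>E UNIV (\<lambda>_ :: nat. C))"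
    using C by (simp add: compactin_PiE)
  then have comp: "compact (Pi\<^sub>E UNIV (\<lambda>_ :: nat. C))"
    by (simp add: euclidean_product_topology)
  have cont: "continuous_on S (\<lambda>x :: nat \<Rightarrow> real ^ 'i. x t $ i)" for S t i
    by (rule continuous_on_subset[OF bounded_linear.continuous_on[OF bounded_linear_vec_nth
            continuous_on_product_coordinates]]) simp
  define H :: "(nat \<Rightarrow> real ^ 'i) set" where
    "H = {x. (\<forall>t. t \<in> {1..T} \<longrightarrow> (\<Sum>i\<in>UNIV. x t $ i) = real K) \<and> (\<forall>g. m $ g \<le> exposure T Ig x g)}"
  have "closed H"
    unfolding H_def exposure_def
    by (intro closed_Collect_conj closed_Collect_all closed_Collect_imp closed_Collect_eq
        closed_Collect_le continuous_on_sum cont continuous_on_const open_Collect_const)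
  with comp have "compact (Pi\<^sub>E UNIV (\<lambda>_ :: nat. C) \<inter> H)" by (rule compact_Int_closed)
  moreover have "continuous_on (Pi\<^sub>E UNIV (\<lambda>_ :: nat. C) \<inter> H) (primal_objective T r)"
    unfolding primal_objective_def
    by (intro continuous_on_sum continuous_on_mult cont continuous_on_const)
  moreover have trunc: "\<exists>z\<in>Pi\<^sub>E UNIV (\<lambda>_ :: nat. C) \<inter> H. primal_objective T r z = primal_objective T r y"
    if y: "y \<in> relaxed_feasible B m" for y
  proof -
    define z :: "nat \<Rightarrow> real ^ 'i" where "z t = (if t \<in> {1..T} then y t else 0)" for t
    have "primal_objective T r z = primal_objective T r y" "exposure T Ig z g = exposure T Ig y g" for g
      by (simp_all add: primal_objective_def exposure_def z_def)
    moreover from this y have "z \<in> Pi\<^sub>E UNIV (\<lambda>_. C) \<inter> H"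
      using B(2) by (auto simp: C_def H_def relaxed_feasible_def relaxed_decisions_def z_def)
    ultimately show ?thesis by blast
  qed
  from this ne have "Pi\<^sub>E UNIV (\<lambda>_ :: nat. C) \<inter> H \<noteq> {}" by blast
  ultimately obtain x where x: "x \<in> Pi\<^sub>E UNIV (\<lambda>_ :: nat. C) \<inter> H"
    "\<forall>y\<in>Pi\<^sub>E UNIV (\<lambda>_ :: nat. C) \<inter> H. primal_objective T r y \<le> primal_objective T r x"
    by (metis continuous_attains_sup)
  show ?thesis
  proof (rule that[of x])
    show "x \<in> relaxed_feasible B m"
      using x(1) by (auto simp: C_def H_def relaxed_feasible_def relaxed_decisions_def)
  next
    fix y assume "y \<in> relaxed_feasible B m"
    then show "primal_objective T r y \<le> primal_objective T r x" using trunc x(2) by metis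
  qed
qed

text \<open>An optimum of the relaxation has, within \<open>{1..T}\<close>, finitely many positive
  entries, gaps to 1 and surpluses; a step no larger than any of these suits the exchange
  argument.\<close>

lemma fractional_strong_duality:
  assumes "relaxed_feasible {0..1} m \<noteq> {}"
  shows "\<exists>x\<in>relaxed_feasible {0..1} m. \<exists>\<mu>. dual_objective T K r Ig m \<mu> = primal_objective T r x"
proof -
  obtain x where x: "x \<in> relaxed_feasible {0..1} m"
    "\<And>y. y \<in> relaxed_feasible {0..1} m \<Longrightarrow> primal_objective T r y \<le> primal_objective T r x"
    using primal_optimum_exists[of "{0..1}" m r] assms by auto
  define S where "S = {s. 0 < s \<and> (s \<in> (\<lambda>(t, i). x t $ i) ` ({1..T} \<times> UNIV)
      \<or> s \<in> (\<lambda>(t, i). 1 - x t $ i) ` ({1..T} \<times> UNIV) \<or> s \<in> range (\<lambda>g. exposure T Ig x g - m $ g))}"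
  define \<delta> where "\<delta> = Min (insert 1 S)"
  have fin: "finite S"
    by (rule finite_subset[of _ "(\<lambda>(t, i). x t $ i) ` ({1..T} \<times> UNIV)
      \<union> (\<lambda>(t, i). 1 - x t $ i) ` ({1..T} \<times> UNIV) \<union> range (\<lambda>g. exposure T Ig x g - m $ g)"])
      (auto simp: S_def)
  have pos: "0 < \<delta>" unfolding \<delta>_def using fin by (subst Min_gr_iff) (auto simp: S_def)
  have le: "\<delta> \<le> s" if "s \<in> S" for s unfolding \<delta>_def using fin that by (intro Min_le) auto
  have x01: "0 \<le> x t $ i \<and> x t $ i \<le> 1" if "t \<in> {1..T}" for t i
    using x(1) that by (simp add: relaxed_feasible_def relaxed_decisions_def)
  have "\<exists>\<mu>. dual_objective T K r Ig m \<mu> = primal_objective T r x"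
  proof (rule dual_attains_primal_optimum[OF _ x pos])
    show "x t $ i - \<delta> \<in> {0..1}" if "t \<in> {1..T}" "0 < x t $ i" for t i
    proof -
      have "x t $ i \<in> S" using that by (force simp: S_def)
      then show ?thesis using le pos x01[OF that(1), of i] by fastforce
    qed
    show "x t $ i + \<delta> \<in> {0..1}" if "t \<in> {1..T}" "x t $ i < 1" for t i
    proof -
      have "1 - x t $ i \<in> S" using that by (force simp: S_def)
      then show ?thesis using le pos x01[OF that(1), of i] by fastforce
    qed
    show "m $ g \<le> exposure T Ig x g - \<delta>" if "m $ g < exposure T Ig x g" for g
    proof -
      have "exposure T Ig x g - m $ g \<in> S" using that by (simp add: S_def)
      then show ?thesis using le by fastforce
    qed
  qed simp_all
  then show ?thesis using x(1) by blast
qed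

section \<open>Integral thresholds: feasible and infeasible case\<close>

lemma exposure_integral:
  assumes "x \<in> decisions T K"
  shows "exposure T Ig x g \<in> \<int>"
proof -
  have "x t $ i \<in> \<int>" if "t \<in> {1..T}" for t i
  proof -
    have "x t $ i = 0 \<or> x t $ i = 1" using assms that by (simp add: decisions_def)
    then show ?thesis by auto
  qed
  then show ?thesis unfolding exposure_def by (intro Ints_sum) auto
qed

text \<open>A unit step is admissible: it flips entries between 0 and 1, and a positive surplus,
  being integral, is at least 1.\<close>

lemma integral_strong_duality:
  assumes int: "\<forall>g. m $ g \<in> \<int>" and ne: "primal_feasible T K Ig m \<noteq> {}"
  obtains x \<mu> where "x \<in> primal_feasible T K Ig m"
    "\<And>y. y \<in> primal_feasible T K Ig m \<Longrightarrow> primal_objective T r y \<le> primal_objective T r x"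
    "dual_objective T K r Ig m \<mu> = primal_objective T r x"
proof -
  obtain x where x: "x \<in> relaxed_feasible {0, 1} m"
    "\<And>y. y \<in> relaxed_feasible {0, 1} m \<Longrightarrow> primal_objective T r y \<le> primal_objective T r x"
    using primal_optimum_exists[of "{0, 1}" m r] ne by (auto simp: primal_feasible_conv_relaxed)
  have x01: "x t $ i = 0 \<or> x t $ i = 1" if "t \<in> {1..T}" for t i
    using x(1) that by (simp add: relaxed_feasible_def relaxed_decisions_def)
  have dec: "x \<in> decisions T K"
    using x(1) by (simp add: relaxed_feasible_def decisions_conv_relaxed)
  have "\<exists>\<mu>. dual_objective T K r Ig m \<mu> = primal_objective T r x"
  proof (rule dual_attains_primal_optimum[OF _ x zero_less_one])
    show "x t $ i - 1 \<in> {0, 1}" if "t \<in> {1..T}" "0 < x t $ i" for t i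
      using x01[OF that(1), of i] that by auto
    show "x t $ i + 1 \<in> {0, 1}" if "t \<in> {1..T}" "x t $ i < 1" for t i
      using x01[OF that(1), of i] that by auto
    show "m $ g \<le> exposure T Ig x g - 1" if "m $ g < exposure T Ig x g" for g
    proof -
      obtain a b where "exposure T Ig x g = of_int a" "m $ g = of_int b"
        using exposure_integral[OF dec] int by (meson Ints_cases)
      then show ?thesis using that by simp
    qed
  qed simp_all
  then show ?thesis using that x by (auto simp: primal_feasible_conv_relaxed)
qed

text \<open>
  Thresholds capped at the exposures of a decision of least total deficit are feasible, but no decision
  meeting them reaches the threshold of a deficient group \<open>h\<close>. An optimal dual solution for
  maximizing the exposure of \<open>h\<close>, lowered by one at \<open>h\<close>, is therefore a direction of unbounded descent.
\<close>

lemma dual_unbounded_below: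
  assumes int: "\<forall>g. m $ g \<in> \<int>" and m: "(\<Sum>g\<in>UNIV. m $ g) \<le> real T * real K"
    and infeas: "primal_feasible T K Ig m = {}"
  shows "\<exists>\<mu>. dual_objective T K r Ig m \<mu> \<le> c"
proof -
  define deficit where "deficit x = (\<Sum>g\<in>UNIV. max 0 (m $ g - exposure T Ig x g))" for x
  \<comment> \<open>Deficits of integral decisions are natural numbers, so a least one
    exists.\<close>
  have deficit_nat: "real (nat \<lfloor>deficit x\<rfloor>) = deficit x" if "x \<in> decisions T K" for x
  proof -
    have "deficit x \<in> \<int>"
      unfolding deficit_def using int exposure_integral[OF that] by (intro Ints_sum) (simp add: max_def)
    moreover have "0 \<le> deficit x" unfolding deficit_def by (intro sum_nonneg) simp
    ultimately show ?thesis by (metis Ints_cases floor_of_int of_int_0_le_iff of_nat_nat)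
  qed
  obtain x0 :: "nat \<Rightarrow> real ^ 'i" where "x0 \<in> decisions T K" using lagrangian_attains_dual_objective[OF m, of r 0] by blast
  then obtain x where x: "x \<in> decisions T K"
    "\<And>y. y \<in> decisions T K \<Longrightarrow> nat \<lfloor>deficit x\<rfloor> \<le> nat \<lfloor>deficit y\<rfloor>"
    using ex_has_least_nat[of "\<lambda>y. y \<in> decisions T K" x0 "\<lambda>y. nat \<lfloor>deficit y\<rfloor>"] by blast
  have least: "deficit x \<le> deficit y" if "y \<in> decisions T K" for y
    using x(2)[OF that] deficit_nat[OF that] deficit_nat[OF x(1)] by (metis of_nat_le_iff)
  define m' :: "real ^ 'g" where "m' = (\<chi> g. min (m $ g) (exposure T Ig x g))"
  have "\<not> (\<forall>g. m $ g \<le> exposure T Ig x g)"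
    using x(1) infeas by (auto simp: primal_feasible_def)
  then obtain h where h: "exposure T Ig x h < m $ h" by (auto simp: not_le)
  define r' :: "nat \<Rightarrow> real ^ 'i" where "r' t = (\<chi> i. of_bool (grp i = h))" for t
  have r': "primal_objective T r' y = exposure T Ig y h" for y
    by (simp add: primal_objective_def r'_def exposure_conv_sum)
  have "x \<in> primal_feasible T K Ig m'" using x(1) by (simp add: primal_feasible_def m'_def)
  moreover have "\<forall>g. m' $ g \<in> \<int>"
    using int exposure_integral[OF x(1)] by (simp add: m'_def min_def)
  ultimately obtain z \<mu> where z: "z \<in> primal_feasible T K Ig m'"
    and \<mu>: "dual_objective T K r' Ig m' \<mu> = exposure T Ig z h"
    using integral_strong_duality[of m' r'] unfolding r' by blast
  define \<eta> where "\<eta> = m $ h - exposure T Ig z h"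
  \<comment> \<open>Otherwise \<open>z\<close> would cure the deficit at \<open>h\<close> without
    enlarging any other, against the minimality of \<open>x\<close>.\<close>
  have \<eta>: "0 < \<eta>"
  proof (rule ccontr)
    assume "\<not> 0 < \<eta>"
    then have zh: "m $ h \<le> exposure T Ig z h" by (simp add: \<eta>_def)
    have "min (m $ g) (exposure T Ig x g) \<le> exposure T Ig z g" for g
      using z by (simp add: primal_feasible_def m'_def)
    then have "max 0 (m $ g - exposure T Ig z g) \<le> max 0 (m $ g - exposure T Ig x g)" for g
      by (smt (verit))
    moreover have "max 0 (m $ h - exposure T Ig z h) < max 0 (m $ h - exposure T Ig x h)"
      using zh h by simp
    ultimately have "deficit z < deficit x"
      unfolding deficit_def by (intro sum_strict_mono_ex1) auto
    moreover have "z \<in> decisions T K" using z by (simp add: primal_feasible_def)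
    ultimately show False using least by force
  qed
  define \<nu> :: "real ^ 'g" where "\<nu> = (\<chi> g. \<mu> $ g - of_bool (g = h))"
  define b where "b = dual_objective T K r Ig m 0"
  \<comment> \<open>Going \<open>s\<close> steps along \<open>\<nu>\<close> lowers the bound
    \<open>b\<close> by at least \<open>s * \<eta>\<close>, which has to cover
    \<open>b - c\<close>.\<close>
  define s where "s = max 0 ((b - c) / \<eta>)"
  obtain y e where y: "y \<in> decisions T K" and e: "e \<in> exposure_vectors T K m"
    and ye: "lagrangian T r Ig (s *\<^sub>R \<nu>) y e = dual_objective T K r Ig m (s *\<^sub>R \<nu>)"
    using lagrangian_attains_dual_objective[OF m] by blast
  have y': "y \<in> relaxed_decisions {0..1}" using y decisions_subset_relaxed by blast
  have "primal_objective T r y \<le> b"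
    using lagrangian_le_dual_objective[OF y' e, of r 0] by (simp add: lagrangian_conv_objective b_def)
  moreover have "(\<Sum>g\<in>UNIV. \<nu> $ g * (e $ g - exposure T Ig y g)) \<le> - \<eta>"
  proof -
    \<comment> \<open>Since \<open>m'\<close> lies below \<open>m\<close>, \<open>e\<close> is
      admissible in the auxiliary problem, whose dual value bounds the part with
      \<open>\<mu>\<close>; lowering \<open>h\<close> by one subtracts
      \<open>e $ h - exposure T Ig y h\<close>.\<close>
    have "e \<in> exposure_vectors T K m'"
      using e by (auto simp: exposure_vectors_def m'_def min_le_iff_disj)
    from lagrangian_le_dual_objective[OF y' this, of r' \<mu>]
    have "exposure T Ig y h + (\<Sum>g\<in>UNIV. \<mu> $ g * (e $ g - exposure T Ig y g)) \<le> exposure T Ig z h"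
      by (simp add: lagrangian_conv_objective r' \<mu>)
    moreover have "m $ h \<le> e $ h" using e by (simp add: exposure_vectors_def)
    moreover have "(\<Sum>g\<in>UNIV. of_bool (g = h) * (e $ g - exposure T Ig y g)) = e $ h - exposure T Ig y h"
    proof -
      have "(\<Sum>g\<in>UNIV. of_bool (g = h) * (e $ g - exposure T Ig y g))
          = (\<Sum>g\<in>UNIV. if g = h then e $ g - exposure T Ig y g else 0)"
        by (intro sum.cong) auto
      then show ?thesis by simp
    qed
    ultimately show ?thesis
      unfolding \<nu>_def vec_lambda_beta left_diff_distrib[of "\<mu> $ _"] sum_subtractf \<eta>_def by linarith
  qed
  then have "s * (\<Sum>g\<in>UNIV. \<nu> $ g * (e $ g - exposure T Ig y g)) \<le> s * - \<eta>"
    by (intro mult_left_mono) (simp_all add: s_def)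
  moreover have "b - c \<le> s * \<eta>"
  proof -
    have "(b - c) / \<eta> \<le> s" by (simp add: s_def)
    then show ?thesis using \<eta> by (simp add: pos_divide_le_eq)
  qed
  ultimately have "dual_objective T K r Ig m (s *\<^sub>R \<nu>) \<le> c"
    unfolding ye[symmetric] lagrangian_conv_objective
    by (simp add: mult.assoc sum_distrib_left[symmetric])
  then show ?thesis by blast
qed

section \<open>Optimal values as extended reals\<close>

lemma dual_function_eq:
  assumes m: "(\<Sum>g\<in>UNIV. m $ g) \<le> real T * real K"
  shows "dual_function T K r Ig m \<mu> = ereal (dual_objective T K r Ig m \<mu>)"
  unfolding dual_function_def
proof (rule antisym)
  show "(SUP (x, e)\<in>decisions T K \<times> exposure_vectors T K m. ereal (lagrangian T r Ig \<mu> x e))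
      \<le> ereal (dual_objective T K r Ig m \<mu>)"
    using lagrangian_le_dual_objective decisions_subset_relaxed by (intro SUP_least) auto
next
  obtain x e where "x \<in> decisions T K" "e \<in> exposure_vectors T K m"
    "lagrangian T r Ig \<mu> x e = dual_objective T K r Ig m \<mu>"
    using lagrangian_attains_dual_objective[OF m] by blast
  then show "ereal (dual_objective T K r Ig m \<mu>)
      \<le> (SUP (x, e)\<in>decisions T K \<times> exposure_vectors T K m. ereal (lagrangian T r Ig \<mu> x e))"
    by (intro SUP_upper2[of "(x, e)"]) auto
qed

text \<open>By weak duality, a relaxed feasible \<open>x\<close> with matching objective certifies
  \<open>\<mu>\<close> as a minimizer.\<close>

lemma dual_value_eqI:
  assumes m: "(\<Sum>g\<in>UNIV. m $ g) \<le> real T * real K"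
    and x: "x \<in> relaxed_feasible {0..1} m"
    and eq: "dual_objective T K r Ig m \<mu> = primal_objective T r x"
  shows "dual_value T K r Ig m = ereal (dual_objective T K r Ig m \<mu>)"
  unfolding dual_value_def dual_function_eq[OF m]
  using weak_duality[OF x] eq by (intro antisym INF_lower INF_greatest) auto

lemma primal_feasible_subset_relaxed: "primal_feasible T K Ig m \<subseteq> relaxed_feasible {0..1} m"
  using decisions_subset_relaxed by (auto simp: primal_feasible_def relaxed_feasible_def)

lemma primal_value_eqI:
  assumes "x \<in> primal_feasible T K Ig m"
    "\<And>y. y \<in> primal_feasible T K Ig m \<Longrightarrow> primal_objective T r y \<le> primal_objective T r x"
  shows "primal_value T K r Ig m = ereal (primal_objective T r x)"
  unfolding primal_value_def using assms by (intro antisym SUP_least SUP_upper) auto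

end

text \<open>If the thresholds summed to more than \<open>T * K\<close>, no exposure vector would
  exist and the dual function would be \<open>-\<infinity>\<close>, unlike the real formula.
  Fractional thresholds can leave a gap: for one time, \<open>K = 1\<close> and two items in two
  groups with thresholds 1/2, no list is feasible, yet the entries 1/2 keep the dual value
  finite.\<close>

theorem theorem1:
  fixes Ig :: "'g::finite \<Rightarrow> 'i::finite set"
    and T K :: nat
    and d :: "real ^ 'p \<Rightarrow> real ^ 'p \<Rightarrow> real"
    and emb_user :: "'u \<Rightarrow> real ^ 'p"
    and emb_item :: "'i \<Rightarrow> real ^ 'p"
    and u :: "nat \<Rightarrow> 'u"
    and r :: "nat \<Rightarrow> real ^ 'i"
    and m :: "real ^ 'g"
  assumes groups: "\<forall>i. \<exists>!g. i \<in> Ig g"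
    and T: "1 \<le> T"
    and K: "1 \<le> K" "K \<le> CARD('i)"
    and r: "r = relevance d emb_user emb_item u"
    and m: "(\<Sum>g\<in>UNIV. m $ g) \<le> real T * real K"
  shows "(\<forall>\<mu>. dual_function T K r Ig m \<mu> = ereal (dual_objective T K r Ig m \<mu>)
            \<and> (\<exists>x\<in>decisions T K. \<exists>e\<in>exposure_vectors T K m.
                  lagrangian T r Ig \<mu> x e = dual_objective T K r Ig m \<mu>))
       \<and> dual_value T K r Ig m = (INF \<mu>. ereal (dual_objective T K r Ig m \<mu>))
       \<and> (primal_feasible T K Ig m \<noteq> {} \<longrightarrow>
            (\<exists>\<mu>. dual_value T K r Ig m = ereal (dual_objective T K r Ig m \<mu>))
          \<and> (\<exists>x\<in>primal_feasible T K Ig m.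
                primal_value T K r Ig m = ereal (primal_objective T r x)))
       \<and> ((\<forall>g. m $ g \<in> \<int>) \<longrightarrow> dual_value T K r Ig m = primal_value T K r Ig m)"
proof -
  interpret grouped_items Ig T K
    using groups K by unfold_locales auto
  have inf: "dual_value T K r Ig m = (INF \<mu>. ereal (dual_objective T K r Ig m \<mu>))"
    by (simp add: dual_value_def dual_function_eq[OF m])
  have dual_attained: "\<exists>\<mu>. dual_value T K r Ig m = ereal (dual_objective T K r Ig m \<mu>)"
    if "primal_feasible T K Ig m \<noteq> {}"
  proof -
    \<comment> \<open>For real thresholds the minimizer comes from the relaxation, whose optimum
      need not be integral.\<close>
    have "relaxed_feasible {0..1} m \<noteq> {}" using that primal_feasible_subset_relaxed by blast
    then show ?thesis using fractional_strong_duality dual_value_eqI[OF m] by blast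
  qed
  have primal_attained: "\<exists>x\<in>primal_feasible T K Ig m.
      primal_value T K r Ig m = ereal (primal_objective T r x)"
    if ne: "primal_feasible T K Ig m \<noteq> {}"
  proof -
    obtain x where "x \<in> primal_feasible T K Ig m"
      "\<And>y. y \<in> primal_feasible T K Ig m \<Longrightarrow> primal_objective T r y \<le> primal_objective T r x"
      using primal_optimum_exists[of "{0, 1}" m r] ne by (auto simp: primal_feasible_conv_relaxed)
    then show ?thesis using primal_value_eqI by blast
  qed
  have strong: "dual_value T K r Ig m = primal_value T K r Ig m" if int: "\<forall>g. m $ g \<in> \<int>"
  proof (cases "primal_feasible T K Ig m = {}")
    case True
    then have "primal_value T K r Ig m = - \<infinity>"
      by (simp add: primal_value_def bot_ereal_def)
    moreover have "dual_value T K r Ig m \<le> ereal c" for c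
    proof -
      obtain \<mu> where "dual_objective T K r Ig m \<mu> \<le> c"
        using dual_unbounded_below[OF int m True] by blast
      then show ?thesis unfolding inf by (intro INF_lower2[of \<mu>]) auto
    qed
    then have "dual_value T K r Ig m = - \<infinity>"
      by (rule ereal_bot)
    ultimately show ?thesis by simp
  next
    case False
    obtain x \<mu> where x: "x \<in> primal_feasible T K Ig m"
      "\<And>y. y \<in> primal_feasible T K Ig m \<Longrightarrow> primal_objective T r y \<le> primal_objective T r x"
      "dual_objective T K r Ig m \<mu> = primal_objective T r x"
      using integral_strong_duality[OF int False] by blast
    then have "dual_value T K r Ig m = ereal (primal_objective T r x)"
      using dual_value_eqI[OF m] primal_feasible_subset_relaxed by (metis subsetD)
    then show ?thesis using primal_value_eqI[OF x(1,2)] by simp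
  qed
  show ?thesis
    using dual_function_eq[OF m] lagrangian_attains_dual_objective[OF m] inf
      dual_attained primal_attained strong
    by simp
qed

end
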